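(* Let $\alpha\in\mathbb{R}$ and $\lambda\ge 0$. Let $n\ge 2$ and $m>n$ be integers, let data points $(x_i,y_i)\in\mathbb{R}^2$, $i=1,\ldots,m$, be given with $x_1<\cdots<x_m$, put $a=x_1$, $b=x_m$, $h=(b-a)/(n-1)$, and let $\xi_\ell=a+(\ell-1)h$ for $\ell=-2,-1,\ldots,n+3$ be the extended uniform knots, so that $\xi_1=a$ and $\xi_n=b$. Let $B^\alpha_0,\ldots,B^\alpha_{n+1}$ be the uniform hyperbolic-polynomial B-splines $B^\alpha_0=B^h_{\boldsymbol{\alpha}h}(\cdot-\xi_{-2})$ and $B^\alpha_j=B^\alpha_0(\cdot-jh)$, $j=1,\ldots,n+1$. Let $s_{hp}=\sum_{j=0}^{n+1}\hat a_jB^\alpha_j$ be the HP-spline with smoothing parameter $\lambda$ approximating the data $(x_i,y_i)$, and let $\hat y_i=s_{hp}(x_i)$, $i=1,\ldots,m$, be the predicted values. Then $$\sum_{i=1}^{m}e^{-\alpha x_i}\hat y_i=\sum_{i=1}^{m}e^{-\alpha x_i}y_i\qquad\text{and}\qquad\sum_{i=1}^{m}x_ie^{-\alpha x_i}\hat y_i=\sum_{i=1}^{m}x_ie^{-\alpha x_i}y_i.$$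
   Context: Hyperbolic-polynomial B-splines (HB-splines): for $\beta\in\mathbb{R}$ let $B^1_\beta(x)=e^{\beta x}\chi_{[0,1]}(x)$. For $\boldsymbol{\beta}=(\beta,\beta,-\beta,-\beta)$ let $B^1_{\boldsymbol{\beta}}=B^1_\beta\ast B^1_\beta\ast B^1_{-\beta}\ast B^1_{-\beta}$ (convolution on $\mathbb{R}$), and for $h>0$ let $B^h_{\boldsymbol{\beta}}(x)=B^1_{\boldsymbol{\beta}}(x/h)$. With $\boldsymbol{\alpha}=(\alpha,\alpha,-\alpha,-\alpha)$, $\boldsymbol{\alpha}h=(\alpha h,\alpha h,-\alpha h,-\alpha h)$, so $$B^h_{\boldsymbol{\alpha}h}(x)=\left(B^1_{\alpha h}\ast B^1_{\alpha h}\ast B^1_{-\alpha h}\ast B^1_{-\alpha h}\right)(x/h),$$ which is supported on $[0,4h]$. Difference operator on sequences: $(\Delta^{h,\alpha}_2\mathbf{a})_j=a_j-2e^{-\alpha h}a_{j-1}+e^{-2\alpha h}a_{j-2}$. HP-spline: the HP-spline approximating the data $(x_i,y_i)$ is $s_{hp}(x)=\sum_{j=0}^{n+1}\hat a_jB^\alpha_j(x)$, where $\hat{\mathbf{a}}=(\hat a_0,\ldots,\hat a_{n+1})^T\in\mathbb{R}^{n+2}$ is a minimizer of $$\sum_{i=1}^m\Big(y_i-\sum_{j=0}^{n+1}a_jB^\alpha_j(x_i)\Big)^2+\lambda\sum_{j=2}^{n+1}\big((\Delta^{h,\alpha}_2\mathbf{a})_j\big)^2$$ over $\mathbf{a}=(a_0,\ldots,a_{n+1})^T\in\mathbb{R}^{n+2}$.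 Equivalently, $\hat{\mathbf{a}}$ solves the linear system $$\left((\mathbf{B}^\alpha)^T\mathbf{B}^\alpha+\lambda(\mathbf{D}^{h,\alpha}_2)^T\mathbf{D}^{h,\alpha}_2\right)\mathbf{a}=(\mathbf{B}^\alpha)^T\mathbf{y},$$ where $\mathbf{y}=(y_1,\ldots,y_m)^T$, $\mathbf{B}^\alpha=(B^\alpha_j(x_i))_{i=1,\ldots,m}^{j=0,\ldots,n+1}\in\mathbb{R}^{m\times(n+2)}$ and $\mathbf{D}^{h,\alpha}_2\in\mathbb{R}^{n\times(n+2)}$ is the matrix with $\mathbf{D}^{h,\alpha}_2\mathbf{a}=((\Delta^{h,\alpha}_2\mathbf{a})_j)_{j=2}^{n+1}$. The vector of predicted values is $\hat{\mathbf{y}}=\mathbf{B}^\alpha\hat{\mathbf{a}}$. *)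

theory Defs
  imports "HOL-Analysis.Analysis"
begin

definition real_conv :: "(real \<Rightarrow> real) \<Rightarrow> (real \<Rightarrow> real) \<Rightarrow> real \<Rightarrow> real" where
  "real_conv f g x = (LINT t|lborel. f t * g (x - t))"

text \<open>The order-one exponential B-spline with unit knot spacing.\<close>

definition exp_bspline1 :: "real \<Rightarrow> real \<Rightarrow> real" where
  "exp_bspline1 \<beta> x = exp (\<beta> * x) * indicator {0..1} x"

text \<open>The HB-spline for the frequency vector \<open>(\<beta>, \<beta>, -\<beta>, -\<beta>)\<close>, with knot spacing 1 and with
  knot spacing \<open>h\<close>. The dilated spline keeps the frequency vector as given, so a spline that is
  piecewise in the span of \<open>exp (\<plusminus>\<alpha> x)\<close>, \<open>x exp (\<plusminus>\<alpha> x)\<close> is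
  \<open>HB_spline h (\<alpha> * h)\<close>.\<close>

definition HB_spline1 :: "real \<Rightarrow> real \<Rightarrow> real" where
  "HB_spline1 \<beta> =
     real_conv (real_conv (real_conv (exp_bspline1 \<beta>) (exp_bspline1 \<beta>))
       (exp_bspline1 (- \<beta>))) (exp_bspline1 (- \<beta>))"

definition HB_spline :: "real \<Rightarrow> real \<Rightarrow> real \<Rightarrow> real" where
  "HB_spline h \<beta> x = HB_spline1 \<beta> (x / h)"

text \<open>Only used for \<open>j \<ge> 2\<close>, where the natural-number subtractions do not truncate.\<close>

definition HP_diff2 :: "real \<Rightarrow> real \<Rightarrow> (nat \<Rightarrow> real) \<Rightarrow> nat \<Rightarrow> real" where
  "HP_diff2 h \<alpha> a j =
     a j - 2 * exp (- \<alpha> * h) * a (j - 1) + exp (- 2 * \<alpha> * h) * a (j - 2)"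

definition HP_comb :: "(nat \<Rightarrow> real \<Rightarrow> real) \<Rightarrow> nat \<Rightarrow> (nat \<Rightarrow> real) \<Rightarrow> real \<Rightarrow> real" where
  "HP_comb B n a t = (\<Sum>j=0..n+1. a j * B j t)"

definition HP_objective ::
  "real \<Rightarrow> real \<Rightarrow> real \<Rightarrow> (nat \<Rightarrow> real \<Rightarrow> real) \<Rightarrow> nat \<Rightarrow> nat
    \<Rightarrow> (nat \<Rightarrow> real) \<Rightarrow> (nat \<Rightarrow> real) \<Rightarrow> (nat \<Rightarrow> real) \<Rightarrow> real" where
  "HP_objective lam \<alpha> h B n m x y a =
     (\<Sum>i=1..m. (y i - HP_comb B n a (x i))\<^sup>2) + lam * (\<Sum>j=2..n+1. (HP_diff2 h \<alpha> a j)\<^sup>2)"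

text \<open>A coefficient vector in \<open>\<real>\<^sup>n\<^sup>+\<^sup>2\<close> is a function on \<open>nat\<close> of which only the values at
  \<open>0, \<dots>, n + 1\<close> matter: neither the objective nor the spline depends on the others. The minimizer
  need not be unique (e.g. for \<open>lam = 0\<close>), hence a predicate rather than a function.\<close>

definition is_HP_spline ::
  "real \<Rightarrow> real \<Rightarrow> real \<Rightarrow> (nat \<Rightarrow> real \<Rightarrow> real) \<Rightarrow> nat \<Rightarrow> nat
    \<Rightarrow> (nat \<Rightarrow> real) \<Rightarrow> (nat \<Rightarrow> real) \<Rightarrow> (real \<Rightarrow> real) \<Rightarrow> bool" where
  "is_HP_spline lam \<alpha> h B n m x y s \<longleftrightarrow>
     (\<exists>a. is_arg_min (HP_objective lam \<alpha> h B n m x y) (\<lambda>_. True) a \<and> s = HP_comb B n a)"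

end

theory Submission imports Defs begin

text \<open>After multiplication by \<open>exp (\<beta> x)\<close>, the two convolutions with \<open>exp_bspline1 (- \<beta>)\<close> become
  two averagings over unit intervals, so the HB-spline is \<open>exp (- \<beta> x)\<close> times the second difference
  of a function that vanishes on the left and is affine on the right of its knots. Summation by parts
  then shows that the coefficients \<open>exp (- \<alpha> h j)\<close> and \<open>j exp (- \<alpha> h j)\<close>, which the penalty
  annihilates, reproduce \<open>exp (- \<alpha> t)\<close> and \<open>t exp (- \<alpha> t)\<close> up to invertible combinations.
  Perturbing the minimizer in these directions shows that the residual is orthogonal to both.\<close>

section \<open>Primitives of functions vanishing on the left half-line\<close>

definition primitive0 :: "(real \<Rightarrow> real) \<Rightarrow> real \<Rightarrow> real" where
  "primitive0 f x = integral {0..x} f"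

lemma primitive0_nonpos: "x \<le> 0 \<Longrightarrow> primitive0 f x = 0"
  by (cases "x = 0") (auto simp: primitive0_def)

text \<open>For negative \<open>x\<close> the interval \<open>{0..x}\<close> is empty and both sides
  are 0; otherwise the piece over \<open>{c..0}\<close> contributes nothing. Moving the base point
  left lets both ends of an interval, or a whole neighbourhood of a point, share one base.\<close>

lemma primitive0_shift_base:
  assumes "continuous_on UNIV f" and "\<And>t. t \<le> 0 \<Longrightarrow> f t = 0" and "c \<le> 0"
  shows "primitive0 f x = integral {c..x} f"
proof (cases "x \<ge> 0")
  case True
  have "f integrable_on {c..x}"
    using assms(1) by (intro integrable_continuous_real) (auto intro: continuous_on_subset)
  then have "integral {c..0} f + integral {0..x} f = integral {c..x} f"
    using True assms(3) by (intro Henstock_Kurzweil_Integration.integral_combine) auto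
  moreover have "integral {c..0} f = 0"
    using assms(2) by (subst Henstock_Kurzweil_Integration.integral_cong[where g = "\<lambda>_. 0"]) auto
  ultimately show ?thesis by (simp add: primitive0_def)
next
  case False
  have "integral {c..x} f = 0"
    using assms(2) False
    by (subst Henstock_Kurzweil_Integration.integral_cong[where g = "\<lambda>_. 0"]) auto
  with False show ?thesis by (simp add: primitive0_nonpos)
qed

lemma integral_eq_primitive0_diff:
  assumes "continuous_on UNIV f" and "\<And>t. t \<le> 0 \<Longrightarrow> f t = 0" and "p \<le> q"
  shows "integral {p..q} f = primitive0 f q - primitive0 f p"
proof -
  define c where "c = min 0 p"
  have "f integrable_on {c..q}"
    using assms(1) by (intro integrable_continuous_real) (auto intro: continuous_on_subset)
  then have "integral {c..p} f + integral {p..q} f = integral {c..q} f"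
    using assms(3) by (intro Henstock_Kurzweil_Integration.integral_combine) (auto simp: c_def)
  moreover have "c \<le> 0" by (simp add: c_def)
  ultimately show ?thesis
    using primitive0_shift_base[OF assms(1,2), of c p] primitive0_shift_base[OF assms(1,2), of c q]
    by linarith
qed

lemma continuous_primitive0:
  assumes "continuous_on UNIV f" and "\<And>t. t \<le> 0 \<Longrightarrow> f t = 0"
  shows "continuous_on UNIV (primitive0 f)"
proof -
  have "isCont (primitive0 f) x" for x
  proof -
    \<comment> \<open>This makes \<open>x\<close> interior to \<open>{c..x+1}\<close> while keeping
      the base point nonpositive.\<close>
    define c where "c = - \<bar>x\<bar> - 1"
    have "c \<le> 0" by (simp add: c_def)
    then have eq: "primitive0 f = (\<lambda>z. integral {c..z} f)"
      using primitive0_shift_base[OF assms] by blast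
    have "continuous_on {c..x+1} (primitive0 f)"
      unfolding eq using assms(1)
      by (intro indefinite_integral_continuous_1 integrable_continuous_real)
        (auto intro: continuous_on_subset)
    then show ?thesis
      by (rule continuous_on_interior) (auto simp: c_def interior_atLeastAtMost_real)
  qed
  then show ?thesis by (simp add: continuous_on_eq_continuous_at)
qed

section \<open>Convolutions of exponential splines\<close>

text \<open>The product \<open>exp (\<gamma> * t) * exp (\<gamma> * (x - t))\<close> does not depend
  on \<open>t\<close>, so it leaves the integral; what remains of the spline is the indicator of a
  unit window.\<close>

lemma real_conv_exp_bspline1:
  assumes "continuous_on UNIV f"
  shows "real_conv (\<lambda>t. exp (\<gamma> * t) * f t) (exp_bspline1 \<gamma>) x = exp (\<gamma> * x) * integral {x-1..x} f"
proof -
  have "exp (\<gamma> * t) * f t * exp_bspline1 \<gamma> (x - t)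
      = exp (\<gamma> * x) * (indicator {x-1..x} t *\<^sub>R f t)" for t
  proof -
    have "exp (\<gamma> * x) = exp (\<gamma> * t) * exp (\<gamma> * (x - t))"
      by (simp add: algebra_simps flip: exp_add)
    then show ?thesis
      by (auto simp: exp_bspline1_def indicator_def)
  qed
  then have "real_conv (\<lambda>t. exp (\<gamma> * t) * f t) (exp_bspline1 \<gamma>) x
      = exp (\<gamma> * x) * (LINT t:{x-1..x}|lborel. f t)"
    by (simp only: real_conv_def set_lebesgue_integral_def integral_mult_right_zero)
  moreover have "set_integrable lborel {x-1..x} f"
    using assms by (intro borel_integrable_atLeastAtMost') (auto intro: continuous_on_subset)
  ultimately show ?thesis by (simp add: set_borel_integral_eq_integral)
qed

text \<open>The length of the intersection of \<open>{0..1}\<close> and \<open>{x-1..x}\<close>: the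
  linear B-spline supported on \<open>{0..2}\<close>.\<close>

definition tent :: "real \<Rightarrow> real" where
  "tent x = max 0 (min 1 x - max 0 (x - 1))"

lemma continuous_tent: "continuous_on UNIV tent"
  unfolding tent_def by (intro continuous_intros)

lemma real_conv_exp_bspline1_self:
  "real_conv (exp_bspline1 \<beta>) (exp_bspline1 \<beta>) x = exp (\<beta> * x) * tent x"
proof -
  have "exp_bspline1 \<beta> t * exp_bspline1 \<beta> (x - t)
      = exp (\<beta> * x) * indicator {max 0 (x - 1)..min 1 x} t" for t
  proof -
    have "exp (\<beta> * x) = exp (\<beta> * t) * exp (\<beta> * (x - t))"
      by (simp add: algebra_simps flip: exp_add)
    then show ?thesis
      by (auto simp: exp_bspline1_def indicator_def)
  qed
  then show ?thesis by (simp add: real_conv_def tent_def content_real_if max_def)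
qed

text \<open>\<open>H\<close> is the second primitive of
  \<open>exp (2 * \<beta> * t) * tent t\<close>. This function lives on \<open>{0..2}\<close>, so
  its first primitive is constant beyond 2, equal to the total integral \<open>M\<close>, and
  \<open>H\<close> is affine there with slope \<open>M\<close>. Each remaining convolution turns
  into one backward difference.\<close>

lemma HB_spline1_second_difference:
  obtains M H D where "M > 0"
    and "\<And>x. HB_spline1 \<beta> x = exp (- \<beta> * x) * (H x - 2 * H (x - 1) + H (x - 2))"
    and "\<And>x. x \<le> 0 \<Longrightarrow> H x = 0"
    and "\<And>x. x \<ge> 2 \<Longrightarrow> H x = M * x + D"
proof -
  \<comment> \<open>The first two factors give \<open>exp (\<beta> * t) * tent t\<close>; extracting
    \<open>exp (- \<beta> * t)\<close>, to match the other two, leaves the exponent doubled.\<close>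
  define F where "F = (\<lambda>t. exp (2 * \<beta> * t) * tent t)"
  define G where "G = primitive0 F"
  define H where "H = primitive0 G"
  define M where "M = G 2"
  have cF: "continuous_on UNIV F"
    unfolding F_def by (intro continuous_intros continuous_tent)
  have F0: "F t = 0" if "t \<le> 0 \<or> t \<ge> 2" for t using that by (auto simp: F_def tent_def)
  have cG: "continuous_on UNIV G"
    unfolding G_def using F0 by (intro continuous_primitive0 cF) auto
  have G0: "G t = 0" if "t \<le> 0" for t using that by (simp add: G_def primitive0_nonpos)
  have diffF: "integral {p..q} F = G q - G p" if "p \<le> q" for p q
    unfolding G_def using F0 that by (intro integral_eq_primitive0_diff cF) auto
  have diffG: "integral {p..q} G = H q - H p" if "p \<le> q" for p q
    unfolding H_def using G0 that by (intro integral_eq_primitive0_diff cG) auto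
  have G2: "G t = M" if "t \<ge> 2" for t
  proof -
    have "integral {2..t} F = 0"
      using F0 by (subst Henstock_Kurzweil_Integration.integral_cong[where g = "\<lambda>_. 0"]) auto
    then show ?thesis using diffF[OF that] by (simp add: M_def)
  qed
  have H2: "H x = M * x + (H 2 - 2 * M)" if "x \<ge> 2" for x
  proof -
    have "integral {2..x} G = M * (x - 2)"
      using G2 that
      by (subst Henstock_Kurzweil_Integration.integral_cong[where g = "\<lambda>_. M"]) auto
    then show ?thesis using diffG[OF that] by (simp add: algebra_simps)
  qed
  have "M > 0"
  proof -
    have nn: "F t \<ge> 0" for t by (simp add: F_def tent_def)
    have c: "continuous_on {0..2} F" using cF by (rule continuous_on_subset) auto
    \<comment> \<open>A nonnegative continuous function with zero integral vanishes identically, but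
      \<open>F\<close> is positive at 1.\<close>
    have "integral {0..2} F \<noteq> 0"
      using integral_eq_0_iff[OF c] nn by (auto simp: F_def tent_def intro!: bexI[of _ 1])
    moreover have "integral {0..2} F \<ge> 0"
      using nn by (intro Henstock_Kurzweil_Integration.integral_nonneg integrable_continuous_real c)
    ultimately show ?thesis by (simp add: M_def G_def primitive0_def)
  qed
  have cGd: "continuous_on UNIV (\<lambda>t. G t - G (t - 1))"
    by (intro continuous_intros cG continuous_on_compose2[OF cG]) auto
  have "real_conv (exp_bspline1 \<beta>) (exp_bspline1 \<beta>) = (\<lambda>t. exp (- \<beta> * t) * F t)"
    by (auto simp: real_conv_exp_bspline1_self F_def fun_eq_iff simp flip: exp_add mult.assoc)
  then have "real_conv (real_conv (exp_bspline1 \<beta>) (exp_bspline1 \<beta>)) (exp_bspline1 (- \<beta>))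
      = (\<lambda>t. exp (- \<beta> * t) * (G t - G (t - 1)))"
    using real_conv_exp_bspline1[OF cF, of "- \<beta>"] by (auto simp: diffF)
  then have "HB_spline1 \<beta> x = exp (- \<beta> * x) * integral {x-1..x} (\<lambda>t. G t - G (t - 1))" for x
    unfolding HB_spline1_def using real_conv_exp_bspline1[OF cGd, of "- \<beta>"] by simp
  moreover have "integral {x-1..x} (\<lambda>t. G t - G (t - 1)) = H x - 2 * H (x - 1) + H (x - 2)" for x
  proof -
    have "integral {x-1..x} (\<lambda>t. G t - G (t - 1))
        = integral {x-1..x} G - integral {x-1..x} (\<lambda>t. G (t - 1))"
      by (intro Henstock_Kurzweil_Integration.integral_diff integrable_continuous_real)
        (auto intro!: continuous_on_subset[OF cG] continuous_on_compose2[OF cG] continuous_intros)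
    \<comment> \<open>The shifted integrand amounts to the window \<open>{x-2..x-1}\<close>,
      adjacent to \<open>{x-1..x}\<close>; hence the three samples of \<open>H\<close>.\<close>
    then show ?thesis
      using integral_shift_real_ivl[of "x - 2" "- 1" "x - 1" G] by (simp add: diffG)
  qed
  ultimately have "HB_spline1 \<beta> x = exp (- \<beta> * x) * (H x - 2 * H (x - 1) + H (x - 2))" for x
    by simp
  moreover have "H x = 0" if "x \<le> 0" for x using that by (simp add: H_def primitive0_nonpos)
  ultimately show ?thesis using that \<open>M > 0\<close> H2 by blast
qed

section \<open>Reproduction of exponentials by HB-splines\<close>

lemma sum_second_difference:
  fixes p :: "nat \<Rightarrow> real"
  shows "(\<Sum>j=0..N. p j - 2 * p (Suc j) + p (Suc (Suc j)))
    = p 0 - p 1 - p (Suc N) + p (Suc (Suc N))"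
  by (induction N) (auto simp: algebra_simps)

text \<open>The weight \<open>real j\<close>, like the constant weight, has zero second difference,
  so summation by parts leaves only boundary values.\<close>

lemma sum_second_difference_weighted:
  fixes p :: "nat \<Rightarrow> real"
  shows "(\<Sum>j=0..N. real j * (p j - 2 * p (Suc j) + p (Suc (Suc j))))
    = p 1 - (real N + 1) * p (Suc N) + real N * p (Suc (Suc N))"
  by (induction N) (auto simp: algebra_simps)

lemma HB_spline1_reproduction:
  obtains M D where "M > 0"
    and "\<And>N u. 3 \<le> u \<Longrightarrow> u \<le> real N + 1 \<Longrightarrow>
      (\<Sum>j=0..N. exp (- \<beta> * real j) * HB_spline1 \<beta> (u - real j)) = exp (- \<beta> * u) * M"
    and "\<And>N u. 3 \<le> u \<Longrightarrow> u \<le> real N + 1 \<Longrightarrow>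
      (\<Sum>j=0..N. real j * exp (- \<beta> * real j) * HB_spline1 \<beta> (u - real j))
        = exp (- \<beta> * u) * (M * u + D)"
proof -
  obtain M H D where M: "M > 0"
    and HB: "\<And>x. HB_spline1 \<beta> x = exp (- \<beta> * x) * (H x - 2 * H (x - 1) + H (x - 2))"
    and H0: "\<And>x. x \<le> 0 \<Longrightarrow> H x = 0"
    and H2: "\<And>x. x \<ge> 2 \<Longrightarrow> H x = M * x + D"
    using HB_spline1_second_difference[of \<beta>] by blast
  define p where "p u j = H (u - real j)" for u j
  have term_eq: "exp (- \<beta> * real j) * HB_spline1 \<beta> (u - real j)
      = exp (- \<beta> * u) * (p u j - 2 * p u (Suc j) + p u (Suc (Suc j)))" for u j
  proof -
    have "exp (- \<beta> * u) = exp (- \<beta> * real j) * exp (- \<beta> * (u - real j))"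
      by (simp add: algebra_simps flip: exp_add)
    then show ?thesis by (simp add: HB p_def algebra_simps)
  qed
  show ?thesis
  \<comment> \<open>In the weighted sum only \<open>p u 1\<close>, that is
    \<open>M * (u - 1) + D\<close>, survives; this shifts the constant by
    \<open>- M\<close>.\<close>
  proof (rule that[of M "D - M"])
    show "M > 0" by (fact M)
  next
    fix N u assume u: "3 \<le> u" "u \<le> real N + 1"
    \<comment> \<open>The upper bound on \<open>u\<close> makes the last two arguments of
      \<open>H\<close> nonpositive; \<open>u \<ge> 3\<close> puts \<open>u - 1\<close>, hence also
      \<open>u\<close>, in the affine range.\<close>
    have p: "p u (Suc N) = 0" "p u (Suc (Suc N)) = 0" "p u 1 = M * (u - 1) + D" "p u 0 = M * u + D"
      using u by (auto simp: p_def H0 H2)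
    show "(\<Sum>j=0..N. exp (- \<beta> * real j) * HB_spline1 \<beta> (u - real j)) = exp (- \<beta> * u) * M"
      unfolding term_eq sum_distrib_left[symmetric] sum_second_difference p
      by (simp add: algebra_simps)
    have "(\<Sum>j=0..N. real j * exp (- \<beta> * real j) * HB_spline1 \<beta> (u - real j))
        = exp (- \<beta> * u) * (\<Sum>j=0..N. real j * (p u j - 2 * p u (Suc j) + p u (Suc (Suc j))))"
      unfolding sum_distrib_left mult.assoc term_eq by (simp add: mult.left_commute)
    then show "(\<Sum>j=0..N. real j * exp (- \<beta> * real j) * HB_spline1 \<beta> (u - real j))
        = exp (- \<beta> * u) * (M * u + (D - M))"
      unfolding sum_second_difference_weighted p by (simp add: algebra_simps)
  qed
qed

section \<open>Optimality of the minimizer and the kernel of the penalty\<close>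

lemma sum_mult_eq_0_of_least_squares:
  fixes r v :: "'a \<Rightarrow> real"
  assumes "\<And>\<epsilon>. (\<Sum>i\<in>A. (r i)\<^sup>2) \<le> (\<Sum>i\<in>A. (r i - \<epsilon> * v i)\<^sup>2)"
  shows "(\<Sum>i\<in>A. v i * r i) = 0"
proof -
  define S where "S = (\<Sum>i\<in>A. v i * r i)"
  define V where "V = (\<Sum>i\<in>A. (v i)\<^sup>2)"
  have V: "V \<ge> 0" by (simp add: V_def sum_nonneg)
  have "(\<Sum>i\<in>A. (r i - \<epsilon> * v i)\<^sup>2) = (\<Sum>i\<in>A. (r i)\<^sup>2) - 2 * \<epsilon> * S + \<epsilon>\<^sup>2 * V" for \<epsilon>
    unfolding S_def V_def sum_distrib_left
    by (simp add: power2_diff power_mult_distrib sum.distrib sum_subtractf mult_ac)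
  then have le: "2 * \<epsilon> * S \<le> \<epsilon>\<^sup>2 * V" for \<epsilon> using assms[of \<epsilon>] by simp
  \<comment> \<open>The optimal step size would be \<open>S / V\<close>; the added 1 covers
    \<open>V = 0\<close> and still forces \<open>S = 0\<close>.\<close>
  from le[of "S / (V + 1)"] have "2 * S\<^sup>2 / (V + 1) \<le> S\<^sup>2 / (V + 1) * (V / (V + 1))"
    by (simp add: power2_eq_square field_simps)
  also have "\<dots> \<le> S\<^sup>2 / (V + 1) * 1"
    using V by (intro mult_left_mono) auto
  finally have "S\<^sup>2 / (V + 1) \<le> 0" by simp
  then have "S\<^sup>2 \<le> 0" using V by (simp add: divide_le_0_iff)
  then show ?thesis by (simp add: S_def)
qed

text \<open>Moving the minimizer along \<open>c\<close> leaves the penalty unchanged, so minimality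
  compares the sums of squared residuals alone.\<close>

lemma HP_residual_orthogonal:
  assumes "is_arg_min (HP_objective lam \<alpha> h B n m x y) (\<lambda>_. True) a"
    and "\<And>j. j \<in> {2..n+1} \<Longrightarrow> HP_diff2 h \<alpha> c j = 0"
  shows "(\<Sum>i=1..m. HP_comb B n c (x i) * (y i - HP_comb B n a (x i))) = 0"
proof (rule sum_mult_eq_0_of_least_squares)
  fix \<epsilon> :: real
  define a' where "a' = (\<lambda>j. a j + \<epsilon> * c j)"
  have "HP_comb B n a' t = HP_comb B n a t + \<epsilon> * HP_comb B n c t" for t
    by (simp add: HP_comb_def a'_def sum_distrib_left algebra_simps flip: sum.distrib)
  moreover have "HP_diff2 h \<alpha> a' j = HP_diff2 h \<alpha> a j" if "j \<in> {2..n+1}" for j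
  proof -
    have "HP_diff2 h \<alpha> a' j = HP_diff2 h \<alpha> a j + \<epsilon> * HP_diff2 h \<alpha> c j"
      by (simp add: HP_diff2_def a'_def algebra_simps)
    with assms(2)[OF that] show ?thesis by simp
  qed
  moreover have "HP_objective lam \<alpha> h B n m x y a \<le> HP_objective lam \<alpha> h B n m x y a'"
    using assms(1) by (simp add: is_arg_min_linorder)
  ultimately show "(\<Sum>i=1..m. (y i - HP_comb B n a (x i))\<^sup>2)
      \<le> (\<Sum>i=1..m. (y i - HP_comb B n a (x i) - \<epsilon> * HP_comb B n c (x i))\<^sup>2)"
    by (simp add: HP_objective_def diff_diff_eq)
qed

text \<open>The characteristic polynomial of the difference operator has the double root
  \<open>exp (- \<alpha> * h)\<close>; its solutions are the geometric sequence and that sequence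
  times the index.\<close>

lemma HP_diff2_affine_times_exp:
  assumes "j \<ge> 2"
  shows "HP_diff2 h \<alpha> (\<lambda>j. (p + q * real j) * exp (- (\<alpha> * h) * real j)) j = 0"
proof -
  obtain k where j: "j = k + 2" using assms by (metis add.commute le_Suc_ex)
  have "exp (- (\<alpha> * h) * real (k + 1)) = exp (- \<alpha> * h) * exp (- (\<alpha> * h) * real k)"
    "exp (- (\<alpha> * h) * real (k + 2)) = exp (- 2 * \<alpha> * h) * exp (- (\<alpha> * h) * real k)"
    "exp (- 2 * \<alpha> * h) = exp (- \<alpha> * h) * exp (- \<alpha> * h)"
    by (simp_all add: algebra_simps flip: exp_add)
  moreover have "k + 2 - 1 = k + 1" "k + 2 - 2 = k" by auto
  ultimately show ?thesis
    unfolding j HP_diff2_def by (simp only:) (simp add: algebra_simps)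
qed

section \<open>Conservation of the two exponential moments\<close>

theorem proposition3p3:
  fixes \<alpha> lam a b h :: real
    and n m :: nat
    and x y yhat :: "nat \<Rightarrow> real"
    and \<xi> :: "int \<Rightarrow> real"
    and B :: "nat \<Rightarrow> real \<Rightarrow> real"
    and s :: "real \<Rightarrow> real"
  assumes "lam \<ge> 0" and "n \<ge> 2" and "m > n"
    and "strict_mono_on {1..m} x"
    and "a = x 1" and "b = x m" and "h = (b - a) / (real n - 1)"
    and "\<forall>l\<in>{-2..int n + 3}. \<xi> l = a + (of_int l - 1) * h"
    and "B 0 = (\<lambda>t. HB_spline h (\<alpha> * h) (t - \<xi> (-2)))"
    and "\<forall>j\<in>{1..n+1}. B j = (\<lambda>t. B 0 (t - real j * h))"
    and "is_HP_spline lam \<alpha> h B n m x y s"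
    and "\<forall>i\<in>{1..m}. yhat i = s (x i)"
  shows "(\<Sum>i=1..m. exp (- \<alpha> * x i) * yhat i) = (\<Sum>i=1..m. exp (- \<alpha> * x i) * y i)
       \<and> (\<Sum>i=1..m. x i * exp (- \<alpha> * x i) * yhat i) = (\<Sum>i=1..m. x i * exp (- \<alpha> * x i) * y i)"
proof -
  from assms(11) obtain c
    where c: "is_arg_min (HP_objective lam \<alpha> h B n m x y) (\<lambda>_. True) c" and s: "s = HP_comb B n c"
    unfolding is_HP_spline_def by blast
  define r where "r i = y i - yhat i" for i
  have r: "y i - HP_comb B n c (x i) = r i" if "i \<in> {1..m}" for i
    using assms(12) that s by (simp add: r_def)
  have "x 1 < x m"
    using assms(2,3) by (intro strict_mono_onD[OF assms(4)]) auto
  then have h: "h > 0" using assms(2,5,6,7) by simp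
  have xb: "a \<le> x i" "x i \<le> b" if "i \<in> {1..m}" for i
    using that assms(2,3,5,6)
    by (auto intro!: monotone_onD[OF strict_mono_on_imp_mono_on[OF assms(4)]])
  \<comment> \<open>The position of \<open>x i\<close> in units of \<open>h\<close>, measured from
    the leftmost knot \<open>a - 3 * h\<close>. As \<open>x i\<close> runs through
    \<open>{a..b}\<close> it stays between 3 and \<open>n + 2\<close>, exactly the reproduction
    range for \<open>N = n + 1\<close>.\<close>
  define u where "u i = (x i - a) / h + 3" for i
  have u: "3 \<le> u i" "u i \<le> real (n + 1) + 1" if "i \<in> {1..m}" for i
  proof -
    show "3 \<le> u i" using xb[OF that] h by (simp add: u_def)
    have "x i - a \<le> (real n - 1) * h" using xb[OF that] assms(2,7) by simp
    then have "(x i - a) / h \<le> real n - 1" using h by (simp add: pos_divide_le_eq)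
    then show "u i \<le> real (n + 1) + 1" by (simp add: u_def)
  qed
  have "\<xi> (- 2) = a - 3 * h" using assms(8) by simp
  then have B: "B j (x i) = HB_spline1 (\<alpha> * h) (u i - real j)" if "j \<in> {0..n+1}" for i j
  proof -
    have "B j (x i) = B 0 (x i - real j * h)"
      using that assms(10) by (cases "j = 0") auto
    moreover have "(x i - real j * h - (a - 3 * h)) / h = u i - real j"
      using h by (simp add: u_def field_simps)
    ultimately show ?thesis
      using \<open>\<xi> (- 2) = a - 3 * h\<close> assms(9) by (simp add: HB_spline_def)
  qed
  \<comment> \<open>The constant by which passing from \<open>u i\<close> back to \<open>x i\<close>
    rescales the exponential.\<close>
  define K where "K = exp (\<alpha> * a - 3 * \<alpha> * h)"
  have K: "exp (- (\<alpha> * h) * u i) = K * exp (- \<alpha> * x i)" for i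
    unfolding K_def exp_add[symmetric] using h by (simp add: u_def field_simps)
  have "K > 0" by (simp add: K_def)
  obtain M D where "M > 0"
    and rep0: "\<And>N u. 3 \<le> u \<Longrightarrow> u \<le> real N + 1 \<Longrightarrow>
      (\<Sum>j=0..N. exp (- (\<alpha> * h) * real j) * HB_spline1 (\<alpha> * h) (u - real j))
        = exp (- (\<alpha> * h) * u) * M"
    and rep1: "\<And>N u. 3 \<le> u \<Longrightarrow> u \<le> real N + 1 \<Longrightarrow>
      (\<Sum>j=0..N. real j * exp (- (\<alpha> * h) * real j) * HB_spline1 (\<alpha> * h) (u - real j))
        = exp (- (\<alpha> * h) * u) * (M * u + D)"
    using HB_spline1_reproduction[of "\<alpha> * h"] by blast
  \<comment> \<open>These coefficient sequences span the kernel of the penalty; their splines at the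
    data points are computed in \<open>v0\<close> and \<open>v1\<close>.\<close>
  define c0 where "c0 j = exp (- (\<alpha> * h) * real j)" for j
  define c1 where "c1 j = real j * exp (- (\<alpha> * h) * real j)" for j
  have v0: "HP_comb B n c0 (x i) = K * M * exp (- \<alpha> * x i)" if "i \<in> {1..m}" for i
    using rep0[OF u[OF that]] unfolding K by (simp add: HP_comb_def c0_def B mult_ac
      del: sum.atLeast0_atMost_Suc)
  have v1: "HP_comb B n c1 (x i) = K * exp (- \<alpha> * x i) * (M * u i + D)" if "i \<in> {1..m}" for i
    using rep1[OF u[OF that]] unfolding K by (simp add: HP_comb_def c1_def B)
  have "(\<Sum>i=1..m. HP_comb B n c0 (x i) * (y i - HP_comb B n c (x i))) = 0"
    using HP_diff2_affine_times_exp[of _ h \<alpha> 1 0]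
    by (intro HP_residual_orthogonal[OF c]) (simp add: c0_def[abs_def])
  then have "K * M * (\<Sum>i=1..m. exp (- \<alpha> * x i) * r i) = 0"
    by (simp add: v0 r sum_distrib_left mult_ac)
  then have orth0: "(\<Sum>i=1..m. exp (- \<alpha> * x i) * r i) = 0"
    using \<open>K > 0\<close> \<open>M > 0\<close> by simp
  have "(\<Sum>i=1..m. HP_comb B n c1 (x i) * (y i - HP_comb B n c (x i))) = 0"
    using HP_diff2_affine_times_exp[of _ h \<alpha> 0 1]
    by (intro HP_residual_orthogonal[OF c]) (simp add: c1_def[abs_def])
  then have "(\<Sum>i=1..m. K * exp (- \<alpha> * x i) * (M * u i + D) * r i) = 0"
    by (simp add: v1 r)
  \<comment> \<open>Substituting \<open>u i\<close> makes \<open>M * u i + D\<close> affine in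
    \<open>x i\<close> with slope \<open>M / h\<close>. The constant part is removed by
    \<open>orth0\<close>, and the slope is nonzero, which isolates the first moment.\<close>
  moreover have "K * exp (- \<alpha> * x i) * (M * u i + D) * r i
      = K * M / h * (x i * exp (- \<alpha> * x i) * r i)
        + K * (3 * M + D - M * a / h) * (exp (- \<alpha> * x i) * r i)" for i
    using h by (simp add: u_def field_simps)
  ultimately have "K * M / h * (\<Sum>i=1..m. x i * exp (- \<alpha> * x i) * r i)
      + K * (3 * M + D - M * a / h) * (\<Sum>i=1..m. exp (- \<alpha> * x i) * r i) = 0"
    by (simp only: sum.distrib sum_distrib_left)
  then have "K * M / h * (\<Sum>i=1..m. x i * exp (- \<alpha> * x i) * r i) = 0"
    unfolding orth0 by simp
  then have orth1: "(\<Sum>i=1..m. x i * exp (- \<alpha> * x i) * r i) = 0"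
    using \<open>K > 0\<close> \<open>M > 0\<close> h by simp
  show ?thesis
    using orth0 orth1 by (simp add: r_def right_diff_distrib sum_subtractf)
qed

end
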